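(* Let $(c_1,\dots,c_{T_C})$ be a scalar context sequence, i.e. an element of $\mathbb{R}^{1\times T_C}$, and let $\overline{\bm{C}}=(\overline{\bm{c}}_1,\dots,\overline{\bm{c}}_{T_C-D+1})\in\mathbb{R}^{D\times(T_C-D+1)}$ be its delay embedding with dimension $D$, defined by $\overline{\bm{c}}_s=(c_s,c_{s+1},\dots,c_{s+D-1})$. Let $f_0$ denote the DynaBase map with $\alpha=0$ (hence $\beta=0$, $\gamma=1$) on the embedded context $\overline{\bm{C}}$, that is, $$f_0(\bm{z})=\overline{\bm{c}}_{\tau(\bm{z})+1},\qquad \tau(\bm{z})=\operatorname{arg\,min}_{1\le s\le T_C-D}\|\overline{\bm{c}}_s-\bm{z}\|_2 .$$ Consider the discrete-time system $\bm{z}_{t+1}=f_0(\bm{z}_t)$ with initial condition $\bm{z}_0=\overline{\bm{c}}_{T_C-D+1}$ and $\tau(\bm{z}_0)\in[1,T_C-2D]$. Then the projection $x_t=z_{D,t}$ (the $D$-th, i.e. last, coordinate of $\bm{z}_t$) exactly reproduces the context-parroting algorithm with motif length $D$ applied to $(c_1,\dots,c_{T_C})$: for $t\ge1$, $x_t$ is the $t$-th value of the forecast emitted by that algorithm.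
   Context: DynaBase: for a context $(\bm{c}_1,\dots,\bm{c}_T)$ in $\mathbb{R}^n$, the DynaBase map is $f_{\alpha,\beta}(\bm{z})=\alpha\bm{z}+\beta\bm{c}_{\tau(\bm{z})}+\gamma\bm{c}_{\tau(\bm{z})+1}$ with $\gamma=1-\alpha-\beta$, where $\tau(\bm{z})=\operatorname{arg\,min}_{s}\|\bm{c}_s-\bm{z}\|_2$ is the nearest-neighbor index. Ties in $\tau$ are broken by the smallest index. Here the map is used in $\mathbb{R}^D$ with the embedded context $(\overline{\bm{c}}_1,\dots,\overline{\bm{c}}_{T_C-D+1})$. Context-parroting algorithm with motif length $D$: the query is the vector of the last $D$ context values, $q=(c_{T_C-D+1},\dots,c_{T_C})$. Motif search: find $s^\star=\operatorname{arg\,min}_{1\le s\le T_C-2D}\|\overline{\bm{c}}_s-q\|_2$, the start of the best-matching length-$D$ motif in the context (the final part of the context is excluded from this search). Copying: emit as forecast, in order, the context values following that motif, $c_{s^\star+D},c_{s^\star+D+1},\dots$. Wrap-around: when the end of the context is reached, the current tail (the last $D$ values) is treated as a new query, and the motif search and copying are repeated.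
   Formalization: Added: for each motif start s with τ(z_0) < s ≤ T_C−D, if the motif first occurs at some r < s then c_{r+D} = c_{s+D}. Without it the claim fails, e.g. D=1, context (5,1,7,5,2,7): parroting emits 5,2, the system gives 5,1. *)

theory Defs
  imports Complex_Main "Jordan_Normal_Form.Matrix"
begin

text \<open>Sequences are indexed from 1, as in \<open>c\<^sub>1, \<dots>, c\<^sub>T\<close>; coordinates of a \<^typ>\<open>real vec\<close> are
  indexed from 0, so the last coordinate of a vector in dimension \<open>D\<close> has index \<open>D - 1\<close>.\<close>

definition entry :: "'a list \<Rightarrow> nat \<Rightarrow> 'a" where
  "entry xs s = xs ! (s - 1)"

definition delay :: "nat \<Rightarrow> real list \<Rightarrow> nat \<Rightarrow> real vec" where
  "delay D xs s = vec D (\<lambda>i. entry xs (s + i))"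

definition norm2 :: "real vec \<Rightarrow> real" where
  "norm2 v = sqrt (v \<bullet> v)"

text \<open>The smallest minimizer of \<open>\<parallel>C s - z\<parallel>\<close> over \<open>1 \<le> s \<le> N\<close>.\<close>

definition nearest :: "(nat \<Rightarrow> real vec) \<Rightarrow> nat \<Rightarrow> real vec \<Rightarrow> nat" where
  "nearest C N z = (LEAST s. is_arg_min (\<lambda>s. norm2 (C s - z)) (\<lambda>s. s \<in> {1..N}) s)"

text \<open>The context is \<open>C 1, \<dots>, C T\<close>. The nearest neighbour is sought among the indices that have
  a successor in the context.\<close>

definition dynabase ::
    "real \<Rightarrow> real \<Rightarrow> (nat \<Rightarrow> real vec) \<Rightarrow> nat \<Rightarrow> real vec \<Rightarrow> real vec" where
  "dynabase \<alpha> \<beta> C T z =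
    (let \<tau> = nearest C (T - 1) z; \<gamma> = 1 - \<alpha> - \<beta>
     in \<alpha> \<cdot>\<^sub>v z + \<beta> \<cdot>\<^sub>v C \<tau> + \<gamma> \<cdot>\<^sub>v C (\<tau> + 1))"

text \<open>Motif search in the context \<open>c\<close>, the query being the last \<open>D\<close> values of \<open>h\<close>.\<close>

definition motif_start :: "nat \<Rightarrow> real list \<Rightarrow> real list \<Rightarrow> nat" where
  "motif_start D c h =
    nearest (delay D c) (length c - 2 * D) (delay D h (length h - D + 1))"

text \<open>The state after \<open>t\<close> emitted values consists of the context followed by these values, and
  the position in the context of the next value to copy. A position beyond the end of the context
  triggers a motif search; the initial search is an instance of this.\<close>

primrec parrot_state :: "nat \<Rightarrow> real list \<Rightarrow> nat \<Rightarrow> real list \<times> nat" where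
  "parrot_state D c 0 = (c, length c + 1)"
| "parrot_state D c (Suc t) =
    (let (h, p) = parrot_state D c t;
         p' = (if p \<le> length c then p else motif_start D c h + D)
     in (h @ [entry c p'], p' + 1))"

definition parrot_forecast :: "nat \<Rightarrow> real list \<Rightarrow> nat \<Rightarrow> real" where
  "parrot_forecast D c t = entry (fst (parrot_state D c t)) (length c + t)"

text \<open>Iterating \<^term>\<open>dynabase 0 0\<close> keeps no memory of a position in the context: on reaching a
  motif that occurs repeatedly, it continues from the smallest index, whereas copying continues in
  place. For \<open>D = 1\<close> and the context \<open>5, 1, 7, 5, 2, 7\<close>, copying gives \<open>5, 2, \<dots>\<close>, but the iteration
  gives \<open>5, 1, \<dots>\<close>. The following condition, which is necessary and sufficient for the two to
  agree, excludes this for the values copied after a match at \<open>m\<close>: if \<open>r\<close> is the first occurrence of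
  the motif that starts at some \<open>s > m\<close>, both occurrences are followed by the same value. It holds
  vacuously if the delay vectors are pairwise distinct.\<close>

definition consistent_repeats :: "nat \<Rightarrow> real list \<Rightarrow> nat \<Rightarrow> bool" where
  "consistent_repeats D c m \<longleftrightarrow>
    (\<forall>s\<in>{m<..length c - D}. \<forall>r\<in>{1..<s}.
       delay D c r = delay D c s \<and> (\<forall>k\<in>{1..<r}. delay D c k \<noteq> delay D c s)
         \<longrightarrow> entry c (r + D) = entry c (s + D))"

end

theory Submission
  imports Defs
begin

text \<open>If the next value to copy is at position \<open>p\<close>, then the state of the iteration is the delay
  vector at \<open>p - D\<close>. It is an exact match for itself, so the iteration moves to the successor of its
  first occurrence; by consistency of the repeats this is also the delay vector at \<open>p + 1 - D\<close>.
  When the end of the context is reached, at least \<open>D\<close> values have been copied since the last search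
  because the match started at most at \<open>length c - 2 * D\<close>. The new query is then the initial one, and
  both systems return to the same match.\<close>

lemma dim_delay [simp]: "dim_vec (delay D c s) = D"
  by (simp add: delay_def)

lemma index_delay [simp]: "i < D \<Longrightarrow> delay D c s $ i = entry c (s + i)"
  by (simp add: delay_def)

lemma delay_eq_iff: "delay D c s = delay D h r \<longleftrightarrow> (\<forall>i<D. entry c (s + i) = entry h (r + i))"
  by (auto simp: vec_eq_iff)

text \<open>The shifted window keeps the last \<open>D - 1\<close> coordinates of the old one and
  gains a single new entry.\<close>

lemma delay_Suc_eqI:
  assumes "delay D c r = delay D c s" "entry c (r + D) = entry c (s + D)"
  shows "delay D c (Suc r) = delay D c (Suc s)"
  unfolding delay_eq_iff
proof (intro allI impI)
  fix i assume "i < D"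
  then consider "Suc i < D" | "Suc i = D" by linarith
  then show "entry c (Suc r + i) = entry c (Suc s + i)"
  proof cases
    case 1
    then have "entry c (r + Suc i) = entry c (s + Suc i)"
      using assms(1) unfolding delay_eq_iff by blast
    then show ?thesis by simp
  next
    case 2
    then show ?thesis using assms(2) by auto
  qed
qed

lemma norm2_nonneg: "0 \<le> norm2 v"
  by (simp add: norm2_def scalar_prod_def sum_nonneg)

lemma norm2_diff_eq_0_iff:
  assumes "dim_vec v = dim_vec w"
  shows "norm2 (v - w) = 0 \<longleftrightarrow> v = w"
proof -
  have "norm2 (v - w) = 0 \<longleftrightarrow> (\<forall>i\<in>{0..<dim_vec w}. (v - w) $ i * (v - w) $ i = 0)"
    unfolding norm2_def scalar_prod_def real_sqrt_eq_0_iff index_minus_vec(2)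
    by (rule sum_nonneg_eq_0_iff) auto
  also have "\<dots> \<longleftrightarrow> (\<forall>i<dim_vec w. v $ i = w $ i)"
    by (simp add: Ball_def)
  also have "\<dots> \<longleftrightarrow> v = w"
    unfolding vec_eq_iff using assms by blast
  finally show ?thesis .
qed

lemma is_arg_min_nearest:
  assumes "1 \<le> N"
  shows "is_arg_min (\<lambda>s. norm2 (C s - z)) (\<lambda>s. s \<in> {1..N}) (nearest C N z)"
proof -
  have "\<exists>s. is_arg_min (\<lambda>s. norm2 (C s - z)) (\<lambda>s. s \<in> {1..N}) s"
    using ex_is_arg_min_if_finite[of "{1..N}" "\<lambda>s. norm2 (C s - z)"] assms by auto
  then show ?thesis
    unfolding nearest_def by (rule LeastI_ex)
qed

text \<open>This reconciles the range of the map with the shorter range of the motif search.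
  Tie-breaking agrees because a minimizer over the short range attains the distance of the global
  one and so competes with it over the long range.\<close>

lemma nearest_restrict:
  assumes "nearest C N z \<in> {1..M}" "M \<le> N"
  shows "nearest C M z = nearest C N z"
proof -
  let ?f = "\<lambda>s. norm2 (C s - z)" and ?n = "nearest C N z"
  have n: "is_arg_min ?f (\<lambda>s. s \<in> {1..N}) ?n"
    using assms by (intro is_arg_min_nearest) auto
  have "(LEAST s. is_arg_min ?f (\<lambda>s. s \<in> {1..M}) s) = ?n"
  proof (rule Least_equality)
    show "is_arg_min ?f (\<lambda>s. s \<in> {1..M}) ?n"
      using n assms by (auto simp: is_arg_min_linorder)
    fix k assume k: "is_arg_min ?f (\<lambda>s. s \<in> {1..M}) k"
    then have "?f k \<le> ?f ?n"
      using assms by (auto simp: is_arg_min_linorder)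
    then have "is_arg_min ?f (\<lambda>s. s \<in> {1..N}) k"
      using n k assms by (force simp: is_arg_min_linorder)
    then show "?n \<le> k"
      unfolding nearest_def by (rule Least_le)
  qed
  then show ?thesis by (simp add: nearest_def[of C M])
qed

text \<open>The distance 0 is attained at \<open>s\<close>, so the minimizers are exactly the exact
  matches, and tie-breaking selects the first.\<close>

lemma nearest_delay_self:
  fixes D c
  assumes s: "s \<in> {1..N}"
  defines "r \<equiv> nearest (delay D c) N (delay D c s)"
  shows "1 \<le> r" "r \<le> s" "delay D c r = delay D c s"
    "\<And>k. k \<in> {1..<r} \<Longrightarrow> delay D c k \<noteq> delay D c s"
proof -
  let ?f = "\<lambda>k. norm2 (delay D c k - delay D c s)"
  have f0: "?f k = 0 \<longleftrightarrow> delay D c k = delay D c s" for k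
    by (simp add: norm2_diff_eq_0_iff)
  have min: "is_arg_min ?f (\<lambda>k. k \<in> {1..N}) r"
    unfolding r_def using s by (intro is_arg_min_nearest) auto
  have least: "r \<le> k" if "k \<in> {1..N}" "delay D c k = delay D c s" for k
  proof -
    have "is_arg_min ?f (\<lambda>k. k \<in> {1..N}) k"
      using that f0[of k] by (auto simp: is_arg_min_linorder norm2_nonneg)
    then show ?thesis
      unfolding r_def nearest_def by (rule Least_le)
  qed
  show "1 \<le> r" using min by (auto simp: is_arg_min_linorder)
  show "r \<le> s" using least s by auto
  have "?f r \<le> ?f s" using min s unfolding is_arg_min_linorder by blast
  then show "delay D c r = delay D c s"
    using f0[of r] f0[of s] norm2_nonneg[of "delay D c r - delay D c s"] by simp
  show "delay D c k \<noteq> delay D c s" if "k \<in> {1..<r}" for k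
    using least[of k] that min by (auto simp: is_arg_min_linorder)
qed

text \<open>The dimension of \<open>z\<close> matters because \<open>0 \<cdot>\<^sub>v z\<close> is
  known to vanish only at indices within that dimension.\<close>

lemma dynabase_0_0_delay:
  assumes "dim_vec z = D"
  shows "dynabase 0 0 (delay D c) T z = delay D c (Suc (nearest (delay D c) (T - 1) z))"
  using assms by (intro eq_vecI) (simp_all add: dynabase_def Let_def)

lemma dynabase_0_0_step:
  assumes "consistent_repeats D c m" "m < s" "s \<le> length c - D"
  shows "dynabase 0 0 (delay D c) (length c - D + 1) (delay D c s) = delay D c (Suc s)"
proof -
  define r where "r = nearest (delay D c) (length c - D) (delay D c s)"
  have "s \<in> {1..length c - D}" using assms by auto
  note r = nearest_delay_self[OF this, where D = D and c = c, folded r_def]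
  have "entry c (r + D) = entry c (s + D)"
  \<comment> \<open>If \<open>r\<close> differs from \<open>s\<close>, it is a strictly earlier
    first occurrence, which is the situation covered by \<open>consistent_repeats\<close>.\<close>
  proof (cases "r = s")
    case False
    then show ?thesis
      using assms r unfolding consistent_repeats_def by auto
  qed simp
  then have "delay D c (Suc r) = delay D c (Suc s)"
    by (rule delay_Suc_eqI[OF r(3)])
  then show ?thesis
    by (simp add: dynabase_0_0_delay r_def)
qed

lemma entry_append_left: "s \<in> {1..length xs} \<Longrightarrow> entry (xs @ ys) s = entry xs s"
  by (auto simp: entry_def nth_append)

lemma entry_snoc: "entry (xs @ [x]) (Suc (length xs)) = x"
  by (simp add: entry_def)

text \<open>The \<open>p - (m + D)\<close> values copied since the last search at \<open>m\<close> are a block of the context. Only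
  this part of the last \<open>D\<close> values, not all of them, agrees with the state of the iteration. At
  \<open>t = 0\<close> the whole context counts as copied.\<close>

lemma parrot_state_invariant:
  fixes z :: "nat \<Rightarrow> real vec"
  assumes z0: "z 0 = delay D c (length c - D + 1)"
    and step: "\<And>t. z (Suc t) = dynabase 0 0 (delay D c) (length c - D + 1) (z t)"
    and m_def: "m = nearest (delay D c) (length c - D) (z 0)"
    and m: "m \<in> {1..length c - 2 * D}"
    and rep: "consistent_repeats D c m"
    and state: "parrot_state D c t = (h, p)"
  shows "length h = length c + t \<and> m + D < p \<and> p \<le> length c + 1 \<and> z t = delay D c (p - D) \<and>
    (\<forall>j < min D (p - (m + D)). entry h (length h - j) = entry c (p - 1 - j))"
  using state
proof (induction t arbitrary: h p)
  case 0
  \<comment> \<open>Here \<open>p = length c + 1\<close>; the range of \<open>m\<close> forces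
    \<open>2 * D < length c\<close>, so no subtraction is truncated.\<close>
  then show ?case using z0 m by (auto simp: Suc_diff_le)
next
  case (Suc t)
  obtain h0 p0 where hp0: "parrot_state D c t = (h0, p0)" by (cases "parrot_state D c t")
  note IH = Suc.IH[OF hp0]
  have len: "length h0 = length c + t" using IH by blast
  have z: "z t = delay D c (p0 - D)" using IH by blast
  have tail: "entry h0 (length h0 - j) = entry c (p0 - 1 - j)" if "j < D" "j < p0 - (m + D)" for j
    using IH that by auto
  show ?case
  proof (cases "p0 \<le> length c")
    case True
    then have hp: "h = h0 @ [entry c p0]" "p = Suc p0"
      using Suc.prems by (auto simp: hp0)
    have "z (Suc t) = delay D c (Suc (p0 - D))"
      unfolding step z using IH True by (intro dynabase_0_0_step[OF rep]) auto
    moreover have "entry h (length h - j) = entry c (p - 1 - j)"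
      if j: "j < D" "j < p - (m + D)" for j
    \<comment> \<open>Offset 0 is the value just appended; offset \<open>Suc i\<close> in
      \<open>h\<close> is offset \<open>i\<close> in \<open>h0\<close>.\<close>
    proof (cases j)
      case 0
      then show ?thesis by (simp add: hp entry_snoc)
    next
      case (Suc i)
      have "length h0 - i \<in> {1..length h0}" using j Suc m len by auto
      then show ?thesis
        using tail[of i] j Suc by (simp add: hp entry_append_left)
    qed
    ultimately show ?thesis
      using IH True by (auto simp: hp Suc_diff_le)
  next
    case False
    then have p0: "p0 = length c + 1" using IH by auto
    \<comment> \<open>From \<open>m \<le> length c - 2 * D\<close> it follows that
      \<open>p0 - (m + D) > D\<close>, so \<open>tail\<close> covers the whole query once its
      indices are counted from the end.\<close>
    have "delay D h0 (length h0 - D + 1) = delay D c (length c - D + 1)"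
      unfolding delay_eq_iff
    proof (intro allI impI)
      fix i assume i: "i < D"
      have "length h0 - D + 1 + i = length h0 - (D - Suc i)"
        "length c - D + 1 + i = p0 - 1 - (D - Suc i)"
        using i m len p0 by auto
      moreover have "D - Suc i < D" "D - Suc i < p0 - (m + D)"
        using i m p0 by auto
      ultimately show "entry h0 (length h0 - D + 1 + i) = entry c (length c - D + 1 + i)"
        using tail by metis
    qed
    \<comment> \<open>The query is now \<open>z 0\<close>, and its match \<open>m\<close> over the
      long range lies in the short one.\<close>
    then have "motif_start D c h0 = m"
      unfolding motif_start_def using m by (auto simp: m_def z0 intro!: nearest_restrict)
    then have hp: "h = h0 @ [entry c (m + D)]" "p = Suc (m + D)"
      using Suc.prems False by (auto simp: hp0 Let_def)
    have "p0 - D = length c - D + 1" using p0 m by auto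
    then have "z t = z 0" using z z0 by simp
    then have "z (Suc t) = delay D c (Suc m)"
      unfolding step by (simp add: z0 m_def dynabase_0_0_delay)
    \<comment> \<open>Now \<open>p - (m + D) = 1\<close>, so at most the appended value has to be
      compared.\<close>
    then show ?thesis
      using len m by (auto simp: hp Suc_diff_le entry_snoc simp flip: len)
  qed
qed

theorem theorem2:
  fixes c :: "real list" and D :: nat and z :: "nat \<Rightarrow> real vec"
  assumes "1 \<le> D"
    and "z 0 = delay D c (length c - D + 1)"
    and "\<And>t. z (Suc t) = dynabase 0 0 (delay D c) (length c - D + 1) (z t)"
    and "nearest (delay D c) (length c - D) (z 0) \<in> {1..length c - 2 * D}"
    and "consistent_repeats D c (nearest (delay D c) (length c - D) (z 0))"
  shows "\<forall>t\<ge>1. z t $ (D - 1) = parrot_forecast D c t"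
proof (intro allI impI)
  fix t :: nat
  obtain h p where hp: "parrot_state D c t = (h, p)" by (cases "parrot_state D c t")
  note inv = parrot_state_invariant[OF assms(2,3) refl assms(4,5) hp]
  have "z t $ (D - 1) = entry c (p - 1)"
    using inv assms(1) by auto
  \<comment> \<open>Offset 0 is within the copied block since \<open>1 \<le> D\<close> and
    \<open>m + D < p\<close>.\<close>
  also have "\<dots> = entry h (length h)"
    using inv[THEN conjunct2, THEN conjunct2, THEN conjunct2, THEN conjunct2, rule_format, of 0]
      inv assms(1) by simp
  also have "\<dots> = parrot_forecast D c t"
    using inv by (simp add: parrot_forecast_def hp)
  finally show "z t $ (D - 1) = parrot_forecast D c t" .
qed

end
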